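(* Let $\mathbb T$ be a time scale and $a,b\in\mathbb T$ with $a<b$. Let $f,g:\mathbb T\to\mathbb R$ be bounded and $\diamondsuit$-integrable functions on $[a,b]_{\mathbb T}$, and let $g$ be nonnegative or nonpositive on $[a,b]_{\mathbb T}$. Let $m$ and $M$ be the infimum and supremum, respectively, of the function $f$. Then there exists a real number $K$ satisfying $m\le K\le M$ such that $$\int_a^b(fg)(t)\,\diamondsuit t=K\int_a^bg(t)\,\diamondsuit t.$$
   Context: A time scale $\mathbb T$ is a nonempty closed subset of $\mathbb R$. $\sigma(t)=\inf\{s\in\mathbb T:s>t\}$, $\rho(t)=\sup\{s\in\mathbb T:s<t\}$, with $\inf\emptyset=\sup\mathbb T$, $\sup\emptyset=\inf\mathbb T$. $[a,b]_{\mathbb T}=\{t\in\mathbb T:a\le t\le b\}$, and half-open intervals similarly. Define $\gamma_1,\gamma_2:\mathbb T\to\mathbb R$ by $$\gamma_1(t)=\lim_{s\to t}\frac{\sigma(t)-s}{\sigma(t)+2t-2s-\rho(t)},\qquad\gamma_2(t)=\lim_{s\to t}\frac{(2t-s)-\rho(t)}{\sigma(t)+2t-2s-\rho(t)}$$ (limits over the real variable $s\ne t$). The diamond integral of $f$ from $a$ to $b$ is $$\int_a^bf(t)\,\diamondsuit t=\int_a^b\gamma_1(t)f(t)\,\Delta t+\int_a^b\gamma_2(t)f(t)\,\nabla t,$$ provided $\gamma_1f$ is delta integrable and $\gamma_2f$ is nabla integrable on $[a,b]_{\mathbb T}$; then $f$ is called $\diamondsuit$-integrable on $[a,b]_{\mathbb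 T}$. Delta and nabla integrals are the standard (Riemann) time scale integrals: the delta (resp. nabla) integral is the limit as $\delta\to0^+$ of sums $\sum_if(\xi_i)(t_i-t_{i-1})$ with $\xi_i\in[t_{i-1},t_i)_{\mathbb T}$ (resp. $\xi_i\in(t_{i-1},t_i]_{\mathbb T}$) over partitions $a=t_0<\dots<t_n=b$ in $\mathbb T$ such that for each $i$ either $t_i-t_{i-1}\le\delta$, or $t_i-t_{i-1}>\delta$ and $\rho(t_i)=t_{i-1}$. If $f$ is integrable and $F^\Delta=f$ (resp. $F^\nabla=f$), the integral equals $F(b)-F(a)$. *)

theory Defs
  imports "HOL-Analysis.Analysis"
begin

text \<open>Functions on a time scale \<open>T\<close> are represented by functions \<open>real \<Rightarrow> real\<close>;
  only their values on \<open>T\<close> matter.\<close>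

definition time_scale :: "real set \<Rightarrow> bool" where
  "time_scale T \<longleftrightarrow> T \<noteq> {} \<and> closed T"

text \<open>The case distinctions implement the conventions
  \<open>inf \<emptyset> = sup T\<close> and \<open>sup \<emptyset> = inf T\<close>. For a time scale, the exceptional cases occur only
  when \<open>T\<close> is bounded on the relevant side.\<close>

definition forward_jump :: "real set \<Rightarrow> real \<Rightarrow> real" where
  "forward_jump T t = (if {s \<in> T. s > t} = {} then Sup T else Inf {s \<in> T. s > t})"

definition backward_jump :: "real set \<Rightarrow> real \<Rightarrow> real" where
  "backward_jump T t = (if {s \<in> T. s < t} = {} then Inf T else Sup {s \<in> T. s < t})"

definition ts_Icc :: "real set \<Rightarrow> real \<Rightarrow> real \<Rightarrow> real set" where
  "ts_Icc T a b = {t \<in> T. a \<le> t \<and> t \<le> b}"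

definition ts_Ico :: "real set \<Rightarrow> real \<Rightarrow> real \<Rightarrow> real set" where
  "ts_Ico T a b = {t \<in> T. a \<le> t \<and> t < b}"

definition ts_Ioc :: "real set \<Rightarrow> real \<Rightarrow> real \<Rightarrow> real set" where
  "ts_Ioc T a b = {t \<in> T. a < t \<and> t \<le> b}"

text \<open>In the two limits below, \<open>s\<close> ranges over all reals different from \<open>t\<close>, not only over
  points of \<open>T\<close>.\<close>

definition gamma1 :: "real set \<Rightarrow> real \<Rightarrow> real" where
  "gamma1 T t = Lim (at t) (\<lambda>s. (forward_jump T t - s) /
     (forward_jump T t + 2 * t - 2 * s - backward_jump T t))"

definition gamma2 :: "real set \<Rightarrow> real \<Rightarrow> real" where
  "gamma2 T t = Lim (at t) (\<lambda>s. ((2 * t - s) - backward_jump T t) /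
     (forward_jump T t + 2 * t - 2 * s - backward_jump T t))"

text \<open>The points \<open>p 0 < \<dots> < p n\<close> partition the interval from \<open>a\<close> to \<open>b\<close>; a subinterval may be
  longer than \<open>\<delta>\<close> only if it spans a gap of \<open>T\<close>.\<close>

definition ts_partition :: "real set \<Rightarrow> real \<Rightarrow> real \<Rightarrow> real \<Rightarrow> nat \<Rightarrow> (nat \<Rightarrow> real) \<Rightarrow> bool" where
  "ts_partition T \<delta> a b n p \<longleftrightarrow>
     p 0 = a \<and> p n = b \<and> (\<forall>i\<le>n. p i \<in> T) \<and> (\<forall>i<n. p i < p (Suc i)) \<and>
     (\<forall>i<n. p (Suc i) - p i \<le> \<delta> \<or>
       (p (Suc i) - p i > \<delta> \<and> backward_jump T (p (Suc i)) = p i))"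

text \<open>Partitions admissible for \<open>\<delta>\<close> are admissible for every larger bound, so the
  limit of the Riemann sums as \<open>\<delta> \<longrightarrow> 0+\<close> takes the following form.\<close>

definition has_delta_integral :: "real set \<Rightarrow> (real \<Rightarrow> real) \<Rightarrow> real \<Rightarrow> real \<Rightarrow> real \<Rightarrow> bool" where
  "has_delta_integral T f a b I \<longleftrightarrow>
     (\<forall>\<epsilon>>0. \<exists>\<delta>>0. \<forall>n p \<xi>.
        ts_partition T \<delta> a b n p \<and> (\<forall>i<n. \<xi> i \<in> ts_Ico T (p i) (p (Suc i))) \<longrightarrow>
        \<bar>(\<Sum>i<n. f (\<xi> i) * (p (Suc i) - p i)) - I\<bar> < \<epsilon>)"

definition has_nabla_integral :: "real set \<Rightarrow> (real \<Rightarrow> real) \<Rightarrow> real \<Rightarrow> real \<Rightarrow> real \<Rightarrow> bool" where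
  "has_nabla_integral T f a b I \<longleftrightarrow>
     (\<forall>\<epsilon>>0. \<exists>\<delta>>0. \<forall>n p \<xi>.
        ts_partition T \<delta> a b n p \<and> (\<forall>i<n. \<xi> i \<in> ts_Ioc T (p i) (p (Suc i))) \<longrightarrow>
        \<bar>(\<Sum>i<n. f (\<xi> i) * (p (Suc i) - p i)) - I\<bar> < \<epsilon>)"

definition delta_integrable :: "real set \<Rightarrow> (real \<Rightarrow> real) \<Rightarrow> real \<Rightarrow> real \<Rightarrow> bool" where
  "delta_integrable T f a b \<longleftrightarrow> (\<exists>I. has_delta_integral T f a b I)"

definition nabla_integrable :: "real set \<Rightarrow> (real \<Rightarrow> real) \<Rightarrow> real \<Rightarrow> real \<Rightarrow> bool" where
  "nabla_integrable T f a b \<longleftrightarrow> (\<exists>I. has_nabla_integral T f a b I)"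

definition delta_integral :: "real set \<Rightarrow> (real \<Rightarrow> real) \<Rightarrow> real \<Rightarrow> real \<Rightarrow> real" where
  "delta_integral T f a b = (THE I. has_delta_integral T f a b I)"

definition nabla_integral :: "real set \<Rightarrow> (real \<Rightarrow> real) \<Rightarrow> real \<Rightarrow> real \<Rightarrow> real" where
  "nabla_integral T f a b = (THE I. has_nabla_integral T f a b I)"

definition diamond_integrable :: "real set \<Rightarrow> (real \<Rightarrow> real) \<Rightarrow> real \<Rightarrow> real \<Rightarrow> bool" where
  "diamond_integrable T f a b \<longleftrightarrow>
     delta_integrable T (\<lambda>t. gamma1 T t * f t) a b \<and>
     nabla_integrable T (\<lambda>t. gamma2 T t * f t) a b"

text \<open>Meaningful only for diamond integrable functions.\<close>

definition diamond_integral :: "real set \<Rightarrow> (real \<Rightarrow> real) \<Rightarrow> real \<Rightarrow> real \<Rightarrow> real" where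
  "diamond_integral T f a b =
     delta_integral T (\<lambda>t. gamma1 T t * f t) a b +
     nabla_integral T (\<lambda>t. gamma2 T t * f t) a b"

end

theory Submission
  imports Defs
begin

text \<open>The crux is the integrability of the product. A function is integrable iff its oscillation
  sums over fine partitions are small, and a product \<open>u * (v + w)\<close> of bounded functions inherits
  this from \<open>u\<close>, \<open>v\<close>, \<open>w\<close>. Since \<open>\<gamma>\<^sub>1 + \<gamma>\<^sub>2 = 1\<close> on the time scale,
  \<open>\<gamma>\<^sub>i f g = (\<gamma>\<^sub>i f) (\<gamma>\<^sub>1 g + \<gamma>\<^sub>2 g)\<close>; one factor on the right is known to be integrable only on
  the other side, but for bounded functions delta and nabla integrability agree. The weights being
  nonnegative, the integral is monotone, and \<open>m g \<le> f g \<le> M g\<close> (or the reverse) gives \<open>K\<close>.\<close>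

subsection \<open>The weights of the diamond integral\<close>

lemma forward_jump_ge:
  assumes "t \<in> T"
  shows "t \<le> forward_jump T t"
proof (cases "{s \<in> T. s > t} = {}")
  case True
  \<comment> \<open>Here t is the maximum of T, so the convention \<open>Sup T\<close> yields t
    itself.\<close>
  then have "\<forall>s\<in>T. s \<le> t" by force
  then have "Sup T = t" using assms by (intro cSup_eq_maximum) auto
  then show ?thesis using True by (simp add: forward_jump_def)
next
  case False
  then have "t \<le> Inf {s \<in> T. s > t}" by (intro cInf_greatest) auto
  then show ?thesis using False by (auto simp: forward_jump_def)
qed

lemma backward_jump_le:
  assumes "t \<in> T"
  shows "backward_jump T t \<le> t"
proof (cases "{s \<in> T. s < t} = {}")
  case True
  then have "\<forall>s\<in>T. s \<ge> t" by force
  then have "Inf T = t" using assms by (intro cInf_eq_minimum) auto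
  then show ?thesis using True by (simp add: backward_jump_def)
next
  case False
  then have "Sup {s \<in> T. s < t} \<le> t" by (intro cSup_least) auto
  then show ?thesis using False by (auto simp: backward_jump_def)
qed

text \<open>For s \<noteq> t both quotients reduce to (t - s) / (2 * (t - s)), constantly 1/2. Only
  the value at s = t is degenerate, and the limit ignores it.\<close>

lemma gamma_dense:
  assumes "forward_jump T t = t" "backward_jump T t = t"
  shows "gamma1 T t = 1/2" "gamma2 T t = 1/2"
proof -
  have "\<forall>\<^sub>F s in at t. s \<noteq> t" by (simp add: eventually_at_filter)
  then have "\<forall>\<^sub>F s in at t. (1/2::real) = (t - s) / (t + 2 * t - 2 * s - t)"
    by eventually_elim (simp add: divide_simps)
  then have *: "((\<lambda>s. (t - s) / (t + 2 * t - 2 * s - t)) \<longlongrightarrow> 1/2) (at t)"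
    by (rule Lim_transform_eventually[OF tendsto_const])
  then show "gamma1 T t = 1/2"
    unfolding gamma1_def assms by (intro tendsto_Lim) auto
  have "2 * t - s - t = t - s" for s by simp
  then show "gamma2 T t = 1/2"
    using * unfolding gamma2_def assms by (intro tendsto_Lim) auto
qed

text \<open>The denominator tends to a nonzero number, so the limit is the quotient at s = t. Points
  dense on exactly one side are included; there the weights are 0 and 1.\<close>

lemma gamma_scattered:
  assumes "forward_jump T t \<noteq> backward_jump T t"
  shows "gamma1 T t = (forward_jump T t - t) / (forward_jump T t - backward_jump T t)"
    "gamma2 T t = (t - backward_jump T t) / (forward_jump T t - backward_jump T t)"
proof -
  have "((\<lambda>s. forward_jump T t + 2 * t - 2 * s - backward_jump T t) \<longlongrightarrow>
      forward_jump T t - backward_jump T t) (at t)"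
    by (auto intro!: tendsto_eq_intros)
  note lim = tendsto_divide[OF _ this] tendsto_Lim
  have ne: "forward_jump T t - backward_jump T t \<noteq> 0" using assms by simp
  show "gamma1 T t = (forward_jump T t - t) / (forward_jump T t - backward_jump T t)"
    unfolding gamma1_def using ne by (intro lim tendsto_intros) auto
  have "((\<lambda>s. 2 * t - s - backward_jump T t) \<longlongrightarrow> t - backward_jump T t) (at t)"
    by (auto intro!: tendsto_eq_intros)
  then show "gamma2 T t = (t - backward_jump T t) / (forward_jump T t - backward_jump T t)"
    unfolding gamma2_def using ne by (intro lim) auto
qed

lemma gamma_nonneg:
  assumes "t \<in> T"
  shows "0 \<le> gamma1 T t" "0 \<le> gamma2 T t"
  using forward_jump_ge[OF assms] backward_jump_le[OF assms] gamma_dense[of T t]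
    gamma_scattered[of T t]
  by (cases "forward_jump T t = backward_jump T t"; force)+

lemma gamma_sum:
  assumes "t \<in> T"
  shows "gamma1 T t + gamma2 T t = 1"
  using forward_jump_ge[OF assms] backward_jump_le[OF assms] gamma_dense[of T t]
    gamma_scattered[of T t]
  by (cases "forward_jump T t = backward_jump T t") (auto simp: add_divide_distrib[symmetric])

subsection \<open>Partitions\<close>

lemma ts_partitionD:
  assumes "ts_partition T \<delta> a b n p"
  shows "p 0 = a" "p n = b" "\<And>i. i \<le> n \<Longrightarrow> p i \<in> T" "\<And>i. i < n \<Longrightarrow> p i < p (Suc i)"
    "\<And>i. i < n \<Longrightarrow> p (Suc i) - p i \<le> \<delta> \<or> backward_jump T (p (Suc i)) = p i"
  using assms unfolding ts_partition_def by blast+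

text \<open>A gap interval whose length lies between the two bounds moves from the second
  alternative of admissibility to the first.\<close>

lemma ts_partition_mono:
  assumes "ts_partition T \<delta> a b n p" "\<delta> \<le> \<delta>'"
  shows "ts_partition T \<delta>' a b n p"
proof -
  have "p (Suc i) - p i \<le> \<delta>' \<or> p (Suc i) - p i > \<delta>' \<and> backward_jump T (p (Suc i)) = p i"
    if "i < n" for i
    using ts_partitionD(5)[OF assms(1) that] assms(2) by linarith
  then show ?thesis using assms(1) unfolding ts_partition_def by blast
qed

lemma ts_partition_points_mono:
  assumes "ts_partition T \<delta> a b n p" "i \<le> j" "j \<le> n"
  shows "p i \<le> p j"
  using assms(2,3)
proof (induction j rule: dec_induct)
  case (step j)
  then show ?case using ts_partitionD(4)[OF assms(1), of j] by simp
qed simp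

lemma ts_partition_bounds:
  assumes "ts_partition T \<delta> a b n p" "i \<le> n"
  shows "p i \<in> T" "a \<le> p i" "p i \<le> b"
  using ts_partitionD(1-3)[OF assms(1)] assms(2) ts_partition_points_mono[OF assms(1), of 0 i]
    ts_partition_points_mono[OF assms(1), of i n] by simp_all

lemmas ts_partition_less = ts_partitionD(4)

lemma ts_partition_extend:
  assumes "ts_partition T \<delta> a x n p" "x < y" "y \<in> T"
    and "y - x \<le> \<delta> \<or> backward_jump T y = x"
  shows "ts_partition T \<delta> a y (Suc n) (p(Suc n := y))"
proof -
  let ?p = "p(Suc n := y)"
  note D = ts_partitionD[OF assms(1)]
  have "?p i \<in> T" if "i \<le> Suc n" for i
    using D(3)[of i] that assms(3) by auto
  moreover have "?p i < ?p (Suc i) \<and> (?p (Suc i) - ?p i \<le> \<delta> \<or>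
      ?p (Suc i) - ?p i > \<delta> \<and> backward_jump T (?p (Suc i)) = ?p i)" if "i < Suc n" for i
  proof (cases "i = n")
    case True
    then show ?thesis using D(2) assms(2,4) by auto
  next
    case False
    then show ?thesis using D(4,5)[of i] that by auto
  qed
  ultimately show ?thesis unfolding ts_partition_def using D(1) by simp
qed

text \<open>Supremum argument over the set \<open>A\<close> of points that an admissible partition
  from a can reach: the supremum is itself reached, and if it were below b, one more short interval
  or gap could be appended.\<close>

lemma ts_partition_exists:
  assumes "time_scale T" "a \<in> T" "b \<in> T" "a < b" "0 < \<delta>"
  shows "\<exists>n p. ts_partition T \<delta> a b n p"
proof -
  define A where "A = {x \<in> ts_Icc T a b. \<exists>n p. ts_partition T \<delta> a x n p}"
  have "closed T" using assms by (simp add: time_scale_def)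
  have "ts_partition T \<delta> a a 0 (\<lambda>_. a)" using assms by (simp add: ts_partition_def)
  then have aA: "a \<in> A" using assms by (auto simp: A_def ts_Icc_def)
  have bdd: "bdd_above A" by (auto simp: A_def ts_Icc_def bdd_above_def)
  define s where "s = Sup A"
  have "closed (ts_Icc T a b)"
  proof -
    have "ts_Icc T a b = T \<inter> {a..b}" by (auto simp: ts_Icc_def)
    then show ?thesis using \<open>closed T\<close> by (simp add: closed_Int)
  qed
  moreover have "s \<in> closure A" unfolding s_def using aA bdd by (intro closure_contains_Sup) auto
  ultimately have sI: "s \<in> ts_Icc T a b"
    using closure_minimal[of A "ts_Icc T a b"] by (auto simp: A_def)
  have up: "x \<le> s" if "x \<in> A" for x unfolding s_def using that bdd by (rule cSup_upper)
  \<comment> \<open>A reachable point within \<delta> of the supremum: one more short interval leads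
    from it to s.\<close>
  obtain x where x: "x \<in> A" "s - \<delta> < x"
    using less_cSup_iff[of A "s - \<delta>"] aA bdd assms(5) unfolding s_def by auto
  have sA: "s \<in> A"
  proof (cases "x = s")
    case False
    then have "x < s" using up x by force
    moreover obtain n p where "ts_partition T \<delta> a x n p" using x unfolding A_def by auto
    ultimately have "ts_partition T \<delta> a s (Suc n) (p(Suc n := s))"
      using x sI by (intro ts_partition_extend) (auto simp: ts_Icc_def)
    then show ?thesis using sI unfolding A_def by auto
  qed (use x in simp)
  then obtain n p where p: "ts_partition T \<delta> a s n p" unfolding A_def by auto
  have "s = b"
  proof (rule ccontr)
    assume "s \<noteq> b"
    then have "s < b" using sI by (auto simp: ts_Icc_def)
    have no: "\<not> (y - s \<le> \<delta> \<or> backward_jump T y = s)" if "s < y" "y \<le> b" "y \<in> T" for y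
    proof
      assume "y - s \<le> \<delta> \<or> backward_jump T y = s"
      then have "y \<in> A" using ts_partition_extend[OF p] that sI unfolding A_def ts_Icc_def by force
      then show False using up that by force
    qed
    \<comment> \<open>By \<open>no\<close>, T has no point in (s, s + \<delta>] up to b. The first
      description of \<open>U\<close> makes it closed, so its infimum is attained; the second shows
      that this infimum y is the first point of T after s, whence a gap from s to y.\<close>
    define U where "U = T \<inter> {s + \<delta>..b}"
    have U: "U = T \<inter> {s<..b}" using no assms(5) by (force simp: U_def)
    define y where "y = Inf U"
    have "b \<in> U" using U \<open>s < b\<close> assms by auto
    moreover have "closed U" unfolding U_def using \<open>closed T\<close> by (simp add: closed_Int)
    moreover have bb: "bdd_below U" unfolding U_def by (auto simp: bdd_below_def)
    ultimately have "y \<in> U" unfolding y_def by (intro closed_contains_Inf) auto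
    then have y: "s < y" "y \<le> b" "y \<in> T" using U by auto
    have "z \<le> s" if "z \<in> T" "z < y" for z
      using that cInf_lower[OF _ bb, of z] U y by (force simp: y_def)
    then have "Sup {z \<in> T. z < y} = s"
      using y sI by (intro cSup_eq_maximum) (auto simp: ts_Icc_def)
    then have "backward_jump T y = s"
      using y sI by (auto simp: backward_jump_def ts_Icc_def)
    then show False using no y by blast
  qed
  then show ?thesis using p by blast
qed

subsection \<open>Overlap lengths\<close>

definition overlap :: "real \<Rightarrow> real \<Rightarrow> real \<Rightarrow> real \<Rightarrow> real" where
  "overlap u v x y = max 0 (min v y - max u x)"

lemma overlap_nonneg: "0 \<le> overlap u v x y"
  by (simp add: overlap_def)

lemma overlap_commute: "overlap u v x y = overlap x y u v"
  by (simp add: overlap_def min.commute max.commute)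

text \<open>Clamping x and y to [u, v] yields the end points of the intersection. In this form,
  overlap lengths telescope along a partition.\<close>

lemma overlap_clamp:
  assumes "u \<le> v" "x \<le> y"
  shows "overlap u v x y = min (max y u) v - min (max x u) v"
  using assms by (auto simp: overlap_def min_def max_def)

lemma sum_overlap:
  assumes "ts_partition T \<delta> a b n p" "u \<le> v"
  shows "(\<Sum>i<n. overlap u v (p i) (p (Suc i))) = min (max b u) v - min (max a u) v"
proof -
  have "(\<Sum>i<n. overlap u v (p i) (p (Suc i)))
      = (\<Sum>i<n. min (max (p (Suc i)) u) v - min (max (p i) u) v)"
    using assms ts_partition_less[OF assms(1)]
    by (intro sum.cong refl overlap_clamp) (auto simp: less_imp_le)
  also have "\<dots> = min (max (p n) u) v - min (max (p 0) u) v"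
    by (rule sum_lessThan_telescope)
  finally show ?thesis using assms by (simp add: ts_partition_def)
qed

lemma sum_overlap_le:
  assumes "ts_partition T \<delta> a b n p" "u \<le> v"
  shows "(\<Sum>i<n. overlap u v (p i) (p (Suc i))) \<le> v - u"
  using sum_overlap[OF assms] by (auto simp: min_def max_def assms)

lemma sum_overlap_eq:
  assumes "ts_partition T \<delta> a b n p" "u \<le> v" "a \<le> u" "v \<le> b"
  shows "(\<Sum>i<n. overlap u v (p i) (p (Suc i))) = v - u"
  using sum_overlap[OF assms(1,2)] assms by (auto simp: min_def max_def)

lemma sum_overlap_partition:
  assumes "ts_partition T \<delta> a b n p" "ts_partition T \<delta>' a b m q" "i < n"
  shows "(\<Sum>j<m. overlap (p i) (p (Suc i)) (q j) (q (Suc j))) = p (Suc i) - p i"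
  using assms ts_partition_bounds[OF assms(1), of i] ts_partition_bounds[OF assms(1), of "Suc i"]
    ts_partition_less[OF assms(1,3)]
  by (intro sum_overlap_eq) auto

subsection \<open>Riemann sums with a side of tagging\<close>

text \<open>The delta and the nabla case differ only in the sets from which tags are taken, so both are
  treated through a parameter \<open>S\<close>.\<close>

definition tagging :: "real set \<Rightarrow> (real \<Rightarrow> real \<Rightarrow> real set) \<Rightarrow> bool" where
  "tagging T S \<longleftrightarrow> S = ts_Ico T \<or> S = ts_Ioc T"

lemma tagging_Ico [simp]: "tagging T (ts_Ico T)"
  and tagging_Ioc [simp]: "tagging T (ts_Ioc T)"
  by (simp_all add: tagging_def)

lemma tagging_subset: "tagging T S \<Longrightarrow> S u v \<subseteq> ts_Icc T u v"
  by (auto simp: tagging_def ts_Ico_def ts_Ioc_def ts_Icc_def)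

lemma tagging_interior: "tagging T S \<Longrightarrow> t \<in> T \<Longrightarrow> u < t \<Longrightarrow> t < v \<Longrightarrow> t \<in> S u v"
  by (auto simp: tagging_def ts_Ico_def ts_Ioc_def)

text \<open>The intersection of the two intervals again has its end points in T; its left end is a
  common delta tag, its right end a common nabla tag.\<close>

lemma tagging_common:
  assumes "tagging T S" "{u, v, x, y} \<subseteq> T" "0 < overlap u v x y"
  shows "S u v \<inter> S x y \<noteq> {}"
proof -
  have "max u x \<in> T" "min v y \<in> T" "max u x < min v y"
    using assms by (auto simp: max_def min_def overlap_def split: if_splits)
  then have "max u x \<in> ts_Ico T u v \<inter> ts_Ico T x y" "min v y \<in> ts_Ioc T u v \<inter> ts_Ioc T x y"
    by (auto simp: ts_Ico_def ts_Ioc_def)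
  then show ?thesis using assms(1) unfolding tagging_def by blast
qed

lemma tagging_nonempty:
  assumes "tagging T S" "u \<in> T" "v \<in> T" "u < v"
  shows "S u v \<noteq> {}"
  using tagging_common[of T S u v u v] assms by (auto simp: overlap_def)

text \<open>T has no point strictly between u and v, so a half-open interval retains a single end
  point. Hence gaps, however long, contribute no oscillation.\<close>

lemma tagging_gap:
  assumes "tagging T S" "backward_jump T v = u" "u < v" "s \<in> S u v" "t \<in> S u v"
  shows "s = t"
proof -
  have "z \<le> u" if "z \<in> T" "z < v" for z
    using assms(2) that cSup_upper[of z "{s \<in> T. s < v}"]
    by (auto simp: backward_jump_def bdd_above_def split: if_splits intro: less_imp_le)
  then have "S u v \<subseteq> {u} \<or> S u v \<subseteq> {v}"
    using assms(1) unfolding tagging_def ts_Ico_def ts_Ioc_def by force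
  then show ?thesis using assms(4,5) by blast
qed

definition tags :: "(real \<Rightarrow> real \<Rightarrow> real set) \<Rightarrow> nat \<Rightarrow> (nat \<Rightarrow> real) \<Rightarrow> (nat \<Rightarrow> real) \<Rightarrow> bool" where
  "tags S n p \<xi> \<longleftrightarrow> (\<forall>i<n. \<xi> i \<in> S (p i) (p (Suc i)))"

definition riemann_sum :: "(real \<Rightarrow> real) \<Rightarrow> nat \<Rightarrow> (nat \<Rightarrow> real) \<Rightarrow> (nat \<Rightarrow> real) \<Rightarrow> real" where
  "riemann_sum f n p \<xi> = (\<Sum>i<n. f (\<xi> i) * (p (Suc i) - p i))"

definition has_tagged_integral ::
    "real set \<Rightarrow> (real \<Rightarrow> real \<Rightarrow> real set) \<Rightarrow> (real \<Rightarrow> real) \<Rightarrow> real \<Rightarrow> real \<Rightarrow> real \<Rightarrow> bool" where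
  "has_tagged_integral T S f a b I \<longleftrightarrow>
     (\<forall>\<epsilon>>0. \<exists>\<delta>>0. \<forall>n p \<xi>. ts_partition T \<delta> a b n p \<and> tags S n p \<xi> \<longrightarrow>
        \<bar>riemann_sum f n p \<xi> - I\<bar> < \<epsilon>)"

lemma has_delta_integral_tagged: "has_delta_integral T = has_tagged_integral T (ts_Ico T)"
  by (simp add: fun_eq_iff has_delta_integral_def has_tagged_integral_def tags_def riemann_sum_def)

lemma has_nabla_integral_tagged: "has_nabla_integral T = has_tagged_integral T (ts_Ioc T)"
  by (simp add: fun_eq_iff has_nabla_integral_def has_tagged_integral_def tags_def riemann_sum_def)

lemma tags_in_Icc:
  assumes "tagging T S" "ts_partition T \<delta> a b n p" "tags S n p \<xi>" "i < n"
  shows "\<xi> i \<in> ts_Icc T a b"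
proof -
  have "\<xi> i \<in> ts_Icc T (p i) (p (Suc i))"
    using assms(3,4) tagging_subset[OF assms(1)] unfolding tags_def by blast
  then show ?thesis
    using ts_partition_bounds[OF assms(2), of i] ts_partition_bounds[OF assms(2), of "Suc i"] assms(4)
    unfolding ts_Icc_def by auto
qed

lemma tags_exist:
  assumes "tagging T S" "ts_partition T \<delta> a b n p"
  shows "\<exists>\<xi>. tags S n p \<xi>"
proof -
  have "\<exists>t. t \<in> S (p i) (p (Suc i))" if "i < n" for i
    using tagging_nonempty[OF assms(1), of "p i" "p (Suc i)"] that
      ts_partition_bounds(1)[OF assms(2)] ts_partition_less[OF assms(2)] by auto
  then show ?thesis unfolding tags_def by metis
qed

section \<open>Monotonicity and uniqueness of the tagged integral\<close>

text \<open>Both integrals are approximated on one partition with the same tags, where the sums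
  compare term by term. The factors \<alpha> and \<beta> later carry m, M and the sign of g.\<close>

lemma has_tagged_integral_le:
  assumes ts: "time_scale T" "a \<in> T" "b \<in> T" "a < b" and S: "tagging T S"
    and u: "has_tagged_integral T S u a b U" and v: "has_tagged_integral T S v a b V"
    and le: "\<And>t. t \<in> ts_Icc T a b \<Longrightarrow> \<alpha> * u t \<le> \<beta> * v t"
  shows "\<alpha> * U \<le> \<beta> * V"
proof (rule field_le_epsilon)
  fix e :: real assume "0 < e"
  \<comment> \<open>The approximation errors are scaled by the absolute values of \<alpha> and
    \<beta> and must total at most e; the 1 keeps the divisor positive.\<close>
  define \<epsilon> where "\<epsilon> = e / (\<bar>\<alpha>\<bar> + \<bar>\<beta>\<bar> + 1)"
  have pos: "0 < \<bar>\<alpha>\<bar> + \<bar>\<beta>\<bar> + 1" by (simp add: add_nonneg_pos)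
  have "0 < \<epsilon>" using \<open>0 < e\<close> pos by (simp add: \<epsilon>_def)
  obtain d1 where d1: "d1 > 0" "\<And>n p \<xi>. ts_partition T d1 a b n p \<Longrightarrow> tags S n p \<xi> \<Longrightarrow>
      \<bar>riemann_sum u n p \<xi> - U\<bar> < \<epsilon>"
    using u \<open>0 < \<epsilon>\<close> unfolding has_tagged_integral_def by meson
  obtain d2 where d2: "d2 > 0" "\<And>n p \<xi>. ts_partition T d2 a b n p \<Longrightarrow> tags S n p \<xi> \<Longrightarrow>
      \<bar>riemann_sum v n p \<xi> - V\<bar> < \<epsilon>"
    using v \<open>0 < \<epsilon>\<close> unfolding has_tagged_integral_def by meson
  obtain n p where p: "ts_partition T (min d1 d2) a b n p"
    using ts_partition_exists[OF ts, of "min d1 d2"] d1(1) d2(1) by auto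
  obtain \<xi> where \<xi>: "tags S n p \<xi>" using tags_exist[OF S p] by blast
  have "\<alpha> * riemann_sum u n p \<xi> \<le> \<beta> * riemann_sum v n p \<xi>"
    unfolding riemann_sum_def sum_distrib_left mult.assoc[symmetric]
    using ts_partition_less[OF p] tags_in_Icc[OF S p \<xi>]
    by (intro sum_mono mult_right_mono le) (auto simp: less_imp_le)
  moreover have "\<bar>\<alpha> * (riemann_sum u n p \<xi> - U)\<bar> \<le> \<bar>\<alpha>\<bar> * \<epsilon>"
    unfolding abs_mult using d1(2)[OF ts_partition_mono[OF p] \<xi>] by (intro mult_left_mono) auto
  moreover have "\<bar>\<beta> * (riemann_sum v n p \<xi> - V)\<bar> \<le> \<bar>\<beta>\<bar> * \<epsilon>"
    unfolding abs_mult using d2(2)[OF ts_partition_mono[OF p] \<xi>] by (intro mult_left_mono) auto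
  moreover have "(\<bar>\<alpha>\<bar> + \<bar>\<beta>\<bar> + 1) * \<epsilon> = e"
    unfolding \<epsilon>_def using pos by simp
  then have "\<bar>\<alpha>\<bar> * \<epsilon> + \<bar>\<beta>\<bar> * \<epsilon> + \<epsilon> = e"
    by (simp add: distrib_right)
  ultimately show "\<alpha> * U \<le> \<beta> * V + e"
    using \<open>0 < \<epsilon>\<close> unfolding right_diff_distrib by linarith
qed

lemma has_tagged_integral_unique:
  assumes "time_scale T" "a \<in> T" "b \<in> T" "a < b" "tagging T S"
    and "has_tagged_integral T S u a b U" "has_tagged_integral T S u a b V"
  shows "U = V"
  using has_tagged_integral_le[OF assms, of 1 1]
    has_tagged_integral_le[OF assms(1-5) assms(7,6), of 1 1] by simp

subsection \<open>Oscillation sums\<close>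

text \<open>Two arbitrary taggings stand in for the supremum and infimum on each interval, so a
  bound on all such sums bounds the difference of upper and lower Darboux sums.\<close>

definition osc_le :: "(real \<Rightarrow> real \<Rightarrow> real set) \<Rightarrow> (real \<Rightarrow> real) \<Rightarrow> nat \<Rightarrow> (nat \<Rightarrow> real) \<Rightarrow> real \<Rightarrow> bool" where
  "osc_le S f n p \<epsilon> \<longleftrightarrow> (\<forall>\<xi> \<eta>. tags S n p \<xi> \<and> tags S n p \<eta> \<longrightarrow>
     (\<Sum>i<n. \<bar>f (\<xi> i) - f (\<eta> i)\<bar> * (p (Suc i) - p i)) \<le> \<epsilon>)"

definition small_osc ::
    "real set \<Rightarrow> (real \<Rightarrow> real \<Rightarrow> real set) \<Rightarrow> (real \<Rightarrow> real) \<Rightarrow> real \<Rightarrow> real \<Rightarrow> bool" where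
  "small_osc T S f a b \<longleftrightarrow>
     (\<forall>\<epsilon>>0. \<exists>\<delta>>0. \<forall>n p. ts_partition T \<delta> a b n p \<longrightarrow> osc_le S f n p \<epsilon>)"

lemma small_oscD:
  assumes "small_osc T S f a b" "0 < \<epsilon>"
  obtains \<delta> where "0 < \<delta>" "\<And>n p. ts_partition T \<delta> a b n p \<Longrightarrow> osc_le S f n p \<epsilon>"
  using assms unfolding small_osc_def by meson

text \<open>Exchanging \<open>\<xi> i\<close> and \<open>\<eta> i\<close> wherever \<open>f (\<xi> i) < f (\<eta> i)\<close> turns the oscillation sum into a
  difference of two Riemann sums.\<close>

lemma has_tagged_integral_imp_small_osc:
  assumes "has_tagged_integral T S f a b I"
  shows "small_osc T S f a b"
  unfolding small_osc_def
proof (intro allI impI)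
  fix \<epsilon> :: real assume "0 < \<epsilon>"
  then obtain \<delta> where \<delta>: "\<delta> > 0" "\<And>n p \<xi>. ts_partition T \<delta> a b n p \<Longrightarrow> tags S n p \<xi> \<Longrightarrow>
      \<bar>riemann_sum f n p \<xi> - I\<bar> < \<epsilon> / 2"
    using assms unfolding has_tagged_integral_def by (meson half_gt_zero)
  have "osc_le S f n p \<epsilon>" if p: "ts_partition T \<delta> a b n p" for n p
    unfolding osc_le_def
  proof (intro allI impI, elim conjE)
    fix \<xi> \<eta> assume *: "tags S n p \<xi>" "tags S n p \<eta>"
    define \<xi>' where "\<xi>' i = (if f (\<xi> i) < f (\<eta> i) then \<eta> i else \<xi> i)" for i
    define \<eta>' where "\<eta>' i = (if f (\<xi> i) < f (\<eta> i) then \<xi> i else \<eta> i)" for i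
    have "(\<Sum>i<n. \<bar>f (\<xi> i) - f (\<eta> i)\<bar> * (p (Suc i) - p i)) = riemann_sum f n p \<xi>' - riemann_sum f n p \<eta>'"
      unfolding riemann_sum_def sum_subtractf[symmetric] left_diff_distrib[symmetric]
      by (intro sum.cong refl) (auto simp: \<xi>'_def \<eta>'_def)
    moreover have "tags S n p \<xi>'" "tags S n p \<eta>'"
      using * by (auto simp: tags_def \<xi>'_def \<eta>'_def)
    ultimately show "(\<Sum>i<n. \<bar>f (\<xi> i) - f (\<eta> i)\<bar> * (p (Suc i) - p i)) \<le> \<epsilon>"
      using \<delta>(2)[OF p, of \<xi>'] \<delta>(2)[OF p, of \<eta>'] by linarith
  qed
  then show "\<exists>\<delta>>0. \<forall>n p. ts_partition T \<delta> a b n p \<longrightarrow> osc_le S f n p \<epsilon>" using \<delta>(1) by blast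
qed

text \<open>The length of each interval of q may be shared among many tag pairs: the pair with the
  largest difference dominates them all, which leaves an ordinary oscillation sum with one pair per
  interval.\<close>

lemma osc_le_weighted:
  fixes n :: nat
  assumes S: "tagging T S" and q: "ts_partition T \<delta> a b m q" and osc: "osc_le S f m q \<epsilon>"
    and L0: "\<And>i j. 0 \<le> L i j"
    and Lsum: "\<And>j. j < m \<Longrightarrow> (\<Sum>i<n. L i j) \<le> q (Suc j) - q j"
    and in_tags: "\<And>i j. i < n \<Longrightarrow> j < m \<Longrightarrow> 0 < L i j \<Longrightarrow>
      x i j \<in> S (q j) (q (Suc j)) \<and> y i j \<in> S (q j) (q (Suc j))"
  shows "(\<Sum>j<m. \<Sum>i<n. \<bar>f (x i j) - f (y i j)\<bar> * L i j) \<le> \<epsilon>"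
proof -
  have "\<exists>u v. u \<in> S (q j) (q (Suc j)) \<and> v \<in> S (q j) (q (Suc j)) \<and>
      (\<forall>i<n. 0 < L i j \<longrightarrow> \<bar>f (x i j) - f (y i j)\<bar> \<le> \<bar>f u - f v\<bar>)" if j: "j < m" for j
  proof (cases "\<exists>i<n. 0 < L i j")
    case True
    \<comment> \<open>Only indices of positive weight compete, since only for them are x and y known
      to be tags.\<close>
    define W where "W = {i \<in> {..<n}. 0 < L i j}"
    have "finite W" "W \<noteq> {}" using True by (auto simp: W_def)
    define w where "w i = \<bar>f (x i j) - f (y i j)\<bar>" for i
    have "Max (w ` W) \<in> w ` W" using \<open>finite W\<close> \<open>W \<noteq> {}\<close> by (intro Max_in) auto
    then obtain k where k: "k \<in> W" "w k = Max (w ` W)" by auto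
    then have "\<forall>i\<in>W. w i \<le> w k" using \<open>finite W\<close> by auto
    then show ?thesis using k(1) in_tags[of k j] j unfolding W_def w_def by blast
  next
    case False
    \<comment> \<open>Without positive weights any tag serves for both u and v.\<close>
    obtain \<zeta> where "tags S m q \<zeta>" using tags_exist[OF S q] by blast
    then show ?thesis using False j unfolding tags_def by blast
  qed
  then obtain \<xi> \<eta> where t: "\<And>j. j < m \<Longrightarrow> \<xi> j \<in> S (q j) (q (Suc j)) \<and> \<eta> j \<in> S (q j) (q (Suc j)) \<and>
      (\<forall>i<n. 0 < L i j \<longrightarrow> \<bar>f (x i j) - f (y i j)\<bar> \<le> \<bar>f (\<xi> j) - f (\<eta> j)\<bar>)"
    by metis
  have "(\<Sum>i<n. \<bar>f (x i j) - f (y i j)\<bar> * L i j) \<le> \<bar>f (\<xi> j) - f (\<eta> j)\<bar> * (q (Suc j) - q j)"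
    if j: "j < m" for j
  proof -
    have "\<bar>f (x i j) - f (y i j)\<bar> * L i j \<le> \<bar>f (\<xi> j) - f (\<eta> j)\<bar> * L i j" if "i < n" for i
      using t[OF j] that L0[of i j] by (cases "L i j = 0") (auto intro!: mult_right_mono)
    then have "(\<Sum>i<n. \<bar>f (x i j) - f (y i j)\<bar> * L i j) \<le> \<bar>f (\<xi> j) - f (\<eta> j)\<bar> * (\<Sum>i<n. L i j)"
      unfolding sum_distrib_left by (intro sum_mono) auto
    also have "\<dots> \<le> \<bar>f (\<xi> j) - f (\<eta> j)\<bar> * (q (Suc j) - q j)"
      using Lsum[OF j] by (intro mult_left_mono) auto
    finally show ?thesis .
  qed
  then have "(\<Sum>j<m. \<Sum>i<n. \<bar>f (x i j) - f (y i j)\<bar> * L i j)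
      \<le> (\<Sum>j<m. \<bar>f (\<xi> j) - f (\<eta> j)\<bar> * (q (Suc j) - q j))"
    by (intro sum_mono) auto
  also have "\<dots> \<le> \<epsilon>" using osc t unfolding osc_le_def tags_def by blast
  finally show ?thesis .
qed

text \<open>The overlap lengths of two partitions replace their common refinement.\<close>

lemma riemann_sum_diff_le:
  assumes S: "tagging T S"
    and p: "ts_partition T \<delta> a b n p" "tags S n p \<xi>" "osc_le S f n p \<epsilon>"
    and q: "ts_partition T \<delta>' a b m q" "tags S m q \<eta>" "osc_le S f m q \<epsilon>'"
  shows "\<bar>riemann_sum f n p \<xi> - riemann_sum f m q \<eta>\<bar> \<le> \<epsilon> + \<epsilon>'"
proof -
  define L where "L i j = overlap (p i) (p (Suc i)) (q j) (q (Suc j))" for i j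
  have L0: "0 \<le> L i j" for i j by (simp add: L_def overlap_nonneg)
  have Lj: "(\<Sum>j<m. L i j) = p (Suc i) - p i" if "i < n" for i
    unfolding L_def by (rule sum_overlap_partition[OF p(1) q(1) that])
  have Li: "(\<Sum>i<n. L i j) = q (Suc j) - q j" if "j < m" for j
    unfolding L_def by (subst overlap_commute) (rule sum_overlap_partition[OF q(1) p(1) that])
  \<comment> \<open>A common tag of two overlapping intervals links \<open>f (\<xi> i)\<close> to
    \<open>f (\<eta> j)\<close>; by the triangle inequality, each half of the difference is an
    oscillation within one partition.\<close>
  have "\<exists>z. z \<in> S (p i) (p (Suc i)) \<and> z \<in> S (q j) (q (Suc j))" if "i < n" "j < m" "0 < L i j" for i j
    using tagging_common[OF S, of "p i" "p (Suc i)" "q j" "q (Suc j)"] that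
      ts_partition_bounds(1)[OF p(1)] ts_partition_bounds(1)[OF q(1)] unfolding L_def by auto
  then obtain z where z: "\<And>i j. i < n \<Longrightarrow> j < m \<Longrightarrow> 0 < L i j \<Longrightarrow>
      z i j \<in> S (p i) (p (Suc i)) \<and> z i j \<in> S (q j) (q (Suc j))" by metis
  have "riemann_sum f n p \<xi> = (\<Sum>i<n. \<Sum>j<m. f (\<xi> i) * L i j)"
    unfolding riemann_sum_def by (simp add: sum_distrib_left[symmetric] Lj)
  moreover have "riemann_sum f m q \<eta> = (\<Sum>i<n. \<Sum>j<m. f (\<eta> j) * L i j)"
    unfolding riemann_sum_def by (subst sum.swap) (simp add: sum_distrib_left[symmetric] Li)
  ultimately have "riemann_sum f n p \<xi> - riemann_sum f m q \<eta>
      = (\<Sum>i<n. \<Sum>j<m. (f (\<xi> i) - f (\<eta> j)) * L i j)"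
    by (simp add: sum_subtractf left_diff_distrib)
  also have "\<bar>\<dots>\<bar> \<le> (\<Sum>i<n. \<Sum>j<m. \<bar>f (\<xi> i) - f (\<eta> j)\<bar> * L i j)"
    by (intro order_trans[OF sum_abs] sum_mono) (simp add: abs_mult L0)
  also have "\<dots> \<le> (\<Sum>i<n. \<Sum>j<m. \<bar>f (\<xi> i) - f (z i j)\<bar> * L i j + \<bar>f (z i j) - f (\<eta> j)\<bar> * L i j)"
    unfolding distrib_right[symmetric] by (intro sum_mono mult_right_mono L0) auto
  also have "\<dots> = (\<Sum>i<n. \<Sum>j<m. \<bar>f (\<xi> i) - f (z i j)\<bar> * L i j)
      + (\<Sum>j<m. \<Sum>i<n. \<bar>f (z i j) - f (\<eta> j)\<bar> * L i j)"
    unfolding sum.distrib by (subst (3) sum.swap) simp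
  also have "\<dots> \<le> \<epsilon> + \<epsilon>'"
  proof (rule add_mono)
    show "(\<Sum>i<n. \<Sum>j<m. \<bar>f (\<xi> i) - f (z i j)\<bar> * L i j) \<le> \<epsilon>"
      using z p(2) Lj L0
      by (intro osc_le_weighted[OF S p(1,3), where L = "\<lambda>j i. L i j" and x = "\<lambda>j i. \<xi> i" and y = "\<lambda>j i. z i j"])
        (auto simp: tags_def)
    show "(\<Sum>j<m. \<Sum>i<n. \<bar>f (z i j) - f (\<eta> j)\<bar> * L i j) \<le> \<epsilon>'"
      using z q(2) Li L0
      by (intro osc_le_weighted[OF S q(1,3), where L = L and x = z and y = "\<lambda>i j. \<eta> j"])
        (auto simp: tags_def)
  qed
  finally show ?thesis .
qed

text \<open>Completeness of the reals: Riemann sums over partitions \<open>P k\<close> with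
  oscillation at most 1/(k+1) form a Cauchy sequence, and every fine partition has sums close to its
  limit, by the same comparison \<open>riemann_sum_diff_le\<close>.\<close>

lemma small_osc_imp_has_tagged_integral:
  assumes ts: "time_scale T" "a \<in> T" "b \<in> T" "a < b" and S: "tagging T S"
    and osc: "small_osc T S f a b"
  shows "\<exists>I. has_tagged_integral T S f a b I"
proof -
  have "\<exists>\<delta> n p \<xi>. ts_partition T \<delta> a b n p \<and> tags S n p \<xi> \<and> osc_le S f n p (inverse (real (Suc k)))" for k
  proof -
    obtain \<delta> where "0 < \<delta>" "\<And>n p. ts_partition T \<delta> a b n p \<Longrightarrow> osc_le S f n p (inverse (real (Suc k)))"
      using small_oscD[OF osc, of "inverse (real (Suc k))"] by auto
    then show ?thesis using ts_partition_exists[OF ts] tags_exist[OF S] by meson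
  qed
  then obtain D N P X where P: "\<And>k. ts_partition T (D k) a b (N k) (P k)"
      "\<And>k. tags S (N k) (P k) (X k)" "\<And>k. osc_le S f (N k) (P k) (inverse (real (Suc k)))"
    by metis
  define s where "s k = riemann_sum f (N k) (P k) (X k)" for k
  have inv0: "(\<lambda>k. inverse (real (Suc k))) \<longlonglongrightarrow> 0" by (rule LIMSEQ_inverse_real_of_nat)
  have "Cauchy s"
  proof (rule CauchyI)
    fix e :: real assume "0 < e"
    then obtain k0 where k0: "inverse (real (Suc k0)) < e / 2"
      using reals_Archimedean[of "e / 2"] by auto
    have "norm (s k - s l) < e" if "k \<ge> k0" "l \<ge> k0" for k l
    proof -
      have "\<bar>s k - s l\<bar> \<le> inverse (real (Suc k)) + inverse (real (Suc l))"
        unfolding s_def by (rule riemann_sum_diff_le[OF S P(1) P(2) P(3) P(1) P(2) P(3)])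
      moreover have "inverse (real (Suc k)) \<le> inverse (real (Suc k0))"
        "inverse (real (Suc l)) \<le> inverse (real (Suc k0))"
        using that by (auto intro!: le_imp_inverse_le)
      ultimately show ?thesis using k0 unfolding real_norm_def by linarith
    qed
    then show "\<exists>M. \<forall>m\<ge>M. \<forall>n\<ge>M. norm (s m - s n) < e" by blast
  qed
  then obtain I where I: "s \<longlonglongrightarrow> I" using Cauchy_convergent_iff convergent_def by metis
  have "has_tagged_integral T S f a b I"
    unfolding has_tagged_integral_def
  proof (intro allI impI)
    fix \<epsilon> :: real assume "0 < \<epsilon>"
    then obtain \<delta> where \<delta>: "0 < \<delta>" "\<And>n p. ts_partition T \<delta> a b n p \<Longrightarrow> osc_le S f n p (\<epsilon> / 2)"
      using small_oscD[OF osc, of "\<epsilon> / 2"] by auto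
    have "\<bar>riemann_sum f n p \<xi> - I\<bar> < \<epsilon>" if p: "ts_partition T \<delta> a b n p" "tags S n p \<xi>" for n p \<xi>
    proof -
      \<comment> \<open>As k grows only \<epsilon>/2 survives, which gives the strict inequality
        required.\<close>
      have "\<bar>riemann_sum f n p \<xi> - s k\<bar> \<le> \<epsilon> / 2 + inverse (real (Suc k))" for k
        unfolding s_def by (rule riemann_sum_diff_le[OF S p \<delta>(2)[OF p(1)] P(1) P(2) P(3)])
      moreover have "(\<lambda>k. \<bar>riemann_sum f n p \<xi> - s k\<bar>) \<longlonglongrightarrow> \<bar>riemann_sum f n p \<xi> - I\<bar>"
        using I by (intro tendsto_intros)
      moreover have "(\<lambda>k. \<epsilon> / 2 + inverse (real (Suc k))) \<longlonglongrightarrow> \<epsilon> / 2 + 0"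
        by (intro tendsto_intros inv0)
      ultimately have "\<bar>riemann_sum f n p \<xi> - I\<bar> \<le> \<epsilon> / 2 + 0"
        by (intro LIMSEQ_le) auto
      then show ?thesis using \<open>0 < \<epsilon>\<close> by simp
    qed
    then show "\<exists>\<delta>>0. \<forall>n p \<xi>. ts_partition T \<delta> a b n p \<and> tags S n p \<xi> \<longrightarrow>
        \<bar>riemann_sum f n p \<xi> - I\<bar> < \<epsilon>" using \<delta>(1) by blast
  qed
  then show ?thesis ..
qed

text \<open>An interval of \<open>p\<close> lying strictly inside an interval of \<open>q\<close> has its tags of either side among
  the tags of \<open>q\<close>. The remaining overlaps contribute only if the interval of \<open>p\<close> is no gap, hence
  at most \<open>\<delta>\<close> long, and then they lie within \<open>\<delta>\<close> of an end point of an interval of \<open>q\<close>.\<close>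

lemma osc_le_switch:
  assumes S: "tagging T S" "tagging T S'"
    and B: "\<And>t. t \<in> ts_Icc T a b \<Longrightarrow> \<bar>f t\<bar> \<le> B"
    and q: "ts_partition T \<delta>' a b m q" "osc_le S' f m q \<epsilon>"
    and p: "ts_partition T \<delta> a b n p" and "0 < \<delta>"
  shows "osc_le S f n p (\<epsilon> + 4 * B * \<delta> * real m)"
  unfolding osc_le_def
proof (intro allI impI, elim conjE)
  fix \<xi> \<eta> assume \<xi>: "tags S n p \<xi>" and \<eta>: "tags S n p \<eta>"
  define w where "w i = \<bar>f (\<xi> i) - f (\<eta> i)\<bar>" for i
  define L where "L i j = overlap (p i) (p (Suc i)) (q j) (q (Suc j))" for i j
  define good where "good i j \<longleftrightarrow> q j < p i \<and> p (Suc i) < q (Suc j)" for i j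
  define L' where "L' i j = (if good i j then L i j else 0)" for i j
  define E where "E i j = overlap (q j) (q j + \<delta>) (p i) (p (Suc i))
    + overlap (q (Suc j) - \<delta>) (q (Suc j)) (p i) (p (Suc i))" for i j
  have L0: "0 \<le> L i j" for i j by (simp add: L_def overlap_nonneg)
  have E0: "0 \<le> E i j" for i j by (simp add: E_def overlap_nonneg)
  have Lj: "(\<Sum>j<m. L i j) = p (Suc i) - p i" if "i < n" for i
    unfolding L_def by (rule sum_overlap_partition[OF p q(1) that])
  have Li: "(\<Sum>i<n. L i j) = q (Suc j) - q j" if "j < m" for j
    unfolding L_def by (subst overlap_commute) (rule sum_overlap_partition[OF q(1) p that])
  have w0: "0 \<le> w i" for i by (simp add: w_def)
  have wB: "w i \<le> 2 * B" if "i < n" for i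
    using B[OF tags_in_Icc[OF S(1) p \<xi> that]] B[OF tags_in_Icc[OF S(1) p \<eta> that]]
    unfolding w_def by linarith
  have "a \<in> ts_Icc T a b"
    using ts_partition_bounds[OF p, of 0] p by (auto simp: ts_partition_def ts_Icc_def)
  then have B0: "0 \<le> B" using B[of a] by linarith
  have step: "w i * L i j \<le> w i * L' i j + 2 * B * E i j" if i: "i < n" and j: "j < m" for i j
  proof (cases "good i j \<or> w i = 0")
    case True
    then show ?thesis using E0[of i j] B0 by (auto simp: L'_def)
  next
    case False
    have "\<not> backward_jump T (p (Suc i)) = p i"
      using False tagging_gap[OF S(1) _ ts_partition_less[OF p i], of "\<xi> i" "\<eta> i"] \<xi> \<eta> i
      unfolding tags_def w_def by auto
    then have "p (Suc i) - p i \<le> \<delta>" using p i unfolding ts_partition_def by auto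
    \<comment> \<open>If \<open>p i \<le> q j\<close>, the overlap ends by
      \<open>q j + \<delta>\<close>; otherwise \<open>q (Suc j) \<le> p (Suc i)\<close>, and it
      starts no earlier than \<open>q (Suc j) - \<delta>\<close>. So one of the two windows in
      \<open>E\<close> contains it.\<close>
    then have "L i j \<le> E i j"
      using False \<open>0 < \<delta>\<close> unfolding L_def E_def good_def overlap_def by (auto simp: max_def min_def)
    then have "w i * L i j \<le> 2 * B * E i j"
      using wB[OF i] L0 B0 by (intro mult_mono) auto
    moreover have "0 \<le> w i * L' i j" using w0[of i] L0[of i j] by (simp add: L'_def)
    ultimately show ?thesis by linarith
  qed
  have "(\<Sum>i<n. w i * (p (Suc i) - p i)) = (\<Sum>i<n. \<Sum>j<m. w i * L i j)"
    by (simp add: sum_distrib_left[symmetric] Lj)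
  also have "\<dots> \<le> (\<Sum>i<n. \<Sum>j<m. w i * L' i j + 2 * B * E i j)"
    using step by (intro sum_mono) auto
  also have "\<dots> = (\<Sum>j<m. \<Sum>i<n. w i * L' i j) + (\<Sum>j<m. 2 * B * (\<Sum>i<n. E i j))"
    by (subst sum.swap) (simp add: sum.distrib sum_distrib_left)
  also have "\<dots> \<le> \<epsilon> + (\<Sum>j<m. 4 * B * \<delta>)"
  proof (rule add_mono)
    have L'sum: "(\<Sum>i<n. L' i j) \<le> q (Suc j) - q j" if "j < m" for j
      unfolding Li[OF that, symmetric] using L0 by (intro sum_mono) (auto simp: L'_def)
    have L'0: "0 \<le> L' i j" for i j using L0 by (simp add: L'_def)
    have L'_tags: "\<xi> i \<in> S' (q j) (q (Suc j)) \<and> \<eta> i \<in> S' (q j) (q (Suc j))"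
      if "i < n" "0 < L' i j" for i j
    proof -
      have "good i j" using that(2) by (auto simp: L'_def split: if_splits)
      then have "S (p i) (p (Suc i)) \<subseteq> S' (q j) (q (Suc j))"
        using tagging_subset[OF S(1), of "p i" "p (Suc i)"] tagging_interior[OF S(2)]
        by (force simp: good_def ts_Icc_def)
      then show ?thesis using \<xi> \<eta> \<open>i < n\<close> unfolding tags_def by blast
    qed
    show "(\<Sum>j<m. \<Sum>i<n. w i * L' i j) \<le> \<epsilon>"
      unfolding w_def
      by (rule osc_le_weighted[OF S(2) q, where L = L' and x = "\<lambda>i j. \<xi> i" and y = "\<lambda>i j. \<eta> i"])
        (fact L'0 L'sum | rule L'_tags, assumption+)+
    \<comment> \<open>Each interval of q has two windows of length \<delta>, on which the values of
      f differ by at most 2 * B.\<close>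
    have "2 * B * (\<Sum>i<n. E i j) \<le> 4 * B * \<delta>" for j
    proof -
      have "(\<Sum>i<n. E i j) \<le> 2 * \<delta>"
        unfolding E_def sum.distrib
        using sum_overlap_le[OF p, of "q j" "q j + \<delta>"]
          sum_overlap_le[OF p, of "q (Suc j) - \<delta>" "q (Suc j)"] \<open>0 < \<delta>\<close> by simp
      then have "2 * B * (\<Sum>i<n. E i j) \<le> 2 * B * (2 * \<delta>)"
        using B0 by (intro mult_left_mono) auto
      then show ?thesis by simp
    qed
    then show "(\<Sum>j<m. 2 * B * (\<Sum>i<n. E i j)) \<le> (\<Sum>j<m. 4 * B * \<delta>)"
      by (intro sum_mono)
  qed
  finally show "(\<Sum>i<n. \<bar>f (\<xi> i) - f (\<eta> i)\<bar> * (p (Suc i) - p i)) \<le> \<epsilon> + 4 * B * \<delta> * real m"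
    by (simp add: w_def mult_ac)
qed

text \<open>One partition q with small oscillation for \<open>S'\<close> is fixed first. Its number
  m of intervals is then a constant, so the error term of \<open>osc_le_switch\<close> vanishes with
  \<delta>.\<close>

lemma small_osc_switch:
  assumes ts: "time_scale T" "a \<in> T" "b \<in> T" "a < b" and S: "tagging T S" "tagging T S'"
    and B: "\<And>t. t \<in> ts_Icc T a b \<Longrightarrow> \<bar>f t\<bar> \<le> B"
    and osc: "small_osc T S' f a b"
  shows "small_osc T S f a b"
  unfolding small_osc_def
proof (intro allI impI)
  fix \<epsilon> :: real assume "0 < \<epsilon>"
  then obtain \<delta>' where \<delta>': "0 < \<delta>'" "\<And>n p. ts_partition T \<delta>' a b n p \<Longrightarrow> osc_le S' f n p (\<epsilon> / 2)"
    using small_oscD[OF osc, of "\<epsilon> / 2"] by auto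
  obtain m q where q: "ts_partition T \<delta>' a b m q" using ts_partition_exists[OF ts \<delta>'(1)] by blast
  have "0 \<le> B" using B[of a] ts by (force simp: ts_Icc_def)
  then have pos: "0 < 8 * B * real m + 1" by (simp add: add_nonneg_pos)
  \<comment> \<open>This makes \<open>4 * B * \<delta> * real m\<close> at most \<epsilon>/2; the 1
    guards against a zero divisor.\<close>
  define \<delta> where "\<delta> = \<epsilon> / (8 * B * real m + 1)"
  have "0 < \<delta>" using \<open>0 < \<epsilon>\<close> pos by (simp add: \<delta>_def)
  have "(8 * B * real m + 1) * \<delta> = \<epsilon>" using pos by (simp add: \<delta>_def)
  then have "\<epsilon> / 2 + 4 * B * \<delta> * real m \<le> \<epsilon>" using \<open>0 < \<delta>\<close> by (simp add: algebra_simps)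
  moreover have "osc_le S f n p (\<epsilon> / 2 + 4 * B * \<delta> * real m)" if "ts_partition T \<delta> a b n p" for n p
    by (rule osc_le_switch[OF S B q \<delta>'(2)[OF q] that \<open>0 < \<delta>\<close>])
  ultimately show "\<exists>\<delta>>0. \<forall>n p. ts_partition T \<delta> a b n p \<longrightarrow> osc_le S f n p \<epsilon>"
    using \<open>0 < \<delta>\<close> unfolding osc_le_def by (meson order_trans)
qed

text \<open>The pointwise bound passes to oscillation sums with the same tags. Three dominating
  functions fit the shape \<open>u * (v + w)\<close>.\<close>

lemma small_osc_dominated:
  assumes S: "tagging T S" and "small_osc T S u a b" "small_osc T S v a b" "small_osc T S w a b"
    and C: "0 \<le> C" "\<And>s t. s \<in> ts_Icc T a b \<Longrightarrow> t \<in> ts_Icc T a b \<Longrightarrow>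
      \<bar>f s - f t\<bar> \<le> C * (\<bar>u s - u t\<bar> + \<bar>v s - v t\<bar> + \<bar>w s - w t\<bar>)"
  shows "small_osc T S f a b"
  unfolding small_osc_def
proof (intro allI impI)
  fix \<epsilon> :: real assume "0 < \<epsilon>"
  define e where "e = \<epsilon> / (3 * C + 1)"
  have "0 < e" using \<open>0 < \<epsilon>\<close> C(1) by (simp add: e_def add_nonneg_pos)
  have "(3 * C + 1) * e = \<epsilon>" using C(1) by (simp add: e_def)
  then have e: "C * (3 * e) \<le> \<epsilon>" using \<open>0 < e\<close> by (simp add: algebra_simps)
  obtain du where du: "0 < du" "\<And>n p. ts_partition T du a b n p \<Longrightarrow> osc_le S u n p e"
    using small_oscD[OF assms(2) \<open>0 < e\<close>] by blast
  obtain dv where dv: "0 < dv" "\<And>n p. ts_partition T dv a b n p \<Longrightarrow> osc_le S v n p e"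
    using small_oscD[OF assms(3) \<open>0 < e\<close>] by blast
  obtain dw where dw: "0 < dw" "\<And>n p. ts_partition T dw a b n p \<Longrightarrow> osc_le S w n p e"
    using small_oscD[OF assms(4) \<open>0 < e\<close>] by blast
  define \<delta> where "\<delta> = min du (min dv dw)"
  have "osc_le S f n p \<epsilon>" if p: "ts_partition T \<delta> a b n p" for n p
    unfolding osc_le_def
  proof (intro allI impI, elim conjE)
    fix \<xi> \<eta> assume t: "tags S n p \<xi>" "tags S n p \<eta>"
    let ?d = "\<lambda>i. p (Suc i) - p i"
    let ?O = "\<lambda>h. \<Sum>i<n. \<bar>h (\<xi> i) - h (\<eta> i)\<bar> * ?d i"
    have "ts_partition T du a b n p" "ts_partition T dv a b n p" "ts_partition T dw a b n p"
      by (rule ts_partition_mono[OF p]; simp add: \<delta>_def)+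
    then have osc: "?O u \<le> e" "?O v \<le> e" "?O w \<le> e"
      using du(2) dv(2) dw(2) t unfolding osc_le_def by blast+
    have "?O f \<le> (\<Sum>i<n. C * (\<bar>u (\<xi> i) - u (\<eta> i)\<bar> + \<bar>v (\<xi> i) - v (\<eta> i)\<bar> + \<bar>w (\<xi> i) - w (\<eta> i)\<bar>) * ?d i)"
      using ts_partition_less[OF p] tags_in_Icc[OF S p t(1)] tags_in_Icc[OF S p t(2)]
      by (intro sum_mono mult_right_mono C(2)) (auto simp: less_imp_le)
    also have "\<dots> = C * (?O u + ?O v + ?O w)"
      by (simp add: sum_distrib_left sum.distrib[symmetric] algebra_simps)
    also have "\<dots> \<le> C * (3 * e)" using osc C(1) by (intro mult_left_mono) auto
    finally show "?O f \<le> \<epsilon>" using e by linarith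
  qed
  moreover have "0 < \<delta>" using du(1) dv(1) dw(1) by (simp add: \<delta>_def)
  ultimately show "\<exists>\<delta>>0. \<forall>n p. ts_partition T \<delta> a b n p \<longrightarrow> osc_le S f n p \<epsilon>" by blast
qed

subsection \<open>Products of diamond integrable functions\<close>

lemma diamond_integrable_iff_small_osc:
  assumes "time_scale T" "a \<in> T" "b \<in> T" "a < b"
  shows "diamond_integrable T f a b \<longleftrightarrow>
    small_osc T (ts_Ico T) (\<lambda>t. gamma1 T t * f t) a b \<and>
    small_osc T (ts_Ioc T) (\<lambda>t. gamma2 T t * f t) a b"
  unfolding diamond_integrable_def delta_integrable_def nabla_integrable_def
    has_delta_integral_tagged has_nabla_integral_tagged
  using small_osc_imp_has_tagged_integral[OF assms] has_tagged_integral_imp_small_osc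
    tagging_Ico tagging_Ioc by metis

lemma gamma_mult_bounds:
  assumes "t \<in> T" "\<bar>f t\<bar> \<le> B"
  shows "\<bar>gamma1 T t * f t\<bar> \<le> B" "\<bar>gamma2 T t * f t\<bar> \<le> B"
proof -
  have "\<bar>gamma1 T t\<bar> \<le> 1" "\<bar>gamma2 T t\<bar> \<le> 1"
    using gamma_nonneg[OF assms(1)] gamma_sum[OF assms(1)] by linarith+
  then have "\<bar>gamma1 T t\<bar> * \<bar>f t\<bar> \<le> 1 * B" "\<bar>gamma2 T t\<bar> * \<bar>f t\<bar> \<le> 1 * B"
    using assms(2) by (intro mult_mono; force)+
  then show "\<bar>gamma1 T t * f t\<bar> \<le> B" "\<bar>gamma2 T t * f t\<bar> \<le> B" by (simp_all add: abs_mult)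
qed

text \<open>Product-rule splitting that keeps u from one point and v' + w' from the other, which is
  where the two bounds enter.\<close>

lemma abs_mult_add_diff_le:
  fixes u u' v v' w w' B :: real
  assumes "\<bar>u\<bar> \<le> B" "\<bar>v' + w'\<bar> \<le> B"
  shows "\<bar>u * (v + w) - u' * (v' + w')\<bar> \<le> B * (\<bar>u - u'\<bar> + \<bar>v - v'\<bar> + \<bar>w - w'\<bar>)"
proof -
  have "u * (v + w) - u' * (v' + w') = u * (v - v') + u * (w - w') + (v' + w') * (u - u')"
    by (simp add: algebra_simps)
  also have "\<bar>\<dots>\<bar> \<le> \<bar>u\<bar> * \<bar>v - v'\<bar> + \<bar>u\<bar> * \<bar>w - w'\<bar> + \<bar>v' + w'\<bar> * \<bar>u - u'\<bar>"
    unfolding abs_mult[symmetric] by linarith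
  also have "\<dots> \<le> B * \<bar>v - v'\<bar> + B * \<bar>w - w'\<bar> + B * \<bar>u - u'\<bar>"
    using assms by (intro add_mono mult_right_mono) auto
  finally show ?thesis by (simp add: algebra_simps)
qed

lemma diamond_integrable_mult:
  assumes ts: "time_scale T" "a \<in> T" "b \<in> T" "a < b"
    and bdd: "bounded (f ` ts_Icc T a b)" "bounded (g ` ts_Icc T a b)"
    and int: "diamond_integrable T f a b" "diamond_integrable T g a b"
  shows "diamond_integrable T (\<lambda>t. f t * g t) a b"
proof -
  obtain Bf Bg where "\<And>t. t \<in> ts_Icc T a b \<Longrightarrow> \<bar>f t\<bar> \<le> Bf" "\<And>t. t \<in> ts_Icc T a b \<Longrightarrow> \<bar>g t\<bar> \<le> Bg"
    using bdd unfolding bounded_iff by auto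
  then obtain B where B: "0 \<le> B" "\<And>t. t \<in> ts_Icc T a b \<Longrightarrow> \<bar>f t\<bar> \<le> B"
      "\<And>t. t \<in> ts_Icc T a b \<Longrightarrow> \<bar>g t\<bar> \<le> B"
    by (metis abs_ge_zero max.cobounded1 max.cobounded2 order_trans abs_le_D1 abs_of_nonneg)
  have T: "t \<in> T" if "t \<in> ts_Icc T a b" for t using that by (simp add: ts_Icc_def)
  define f1 f2 g1 g2 where "f1 = (\<lambda>t. gamma1 T t * f t)" and "f2 = (\<lambda>t. gamma2 T t * f t)"
    and "g1 = (\<lambda>t. gamma1 T t * g t)" and "g2 = (\<lambda>t. gamma2 T t * g t)"
  note defs = f1_def f2_def g1_def g2_def
  have f: "\<bar>f1 t\<bar> \<le> B" "\<bar>f2 t\<bar> \<le> B" if "t \<in> ts_Icc T a b" for t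
    unfolding defs using gamma_mult_bounds[of t T f, OF T B(2)] that by blast+
  have g: "\<bar>g1 t\<bar> \<le> B" "\<bar>g2 t\<bar> \<le> B" if "t \<in> ts_Icc T a b" for t
    unfolding defs using gamma_mult_bounds[of t T g, OF T B(3)] that by blast+
  have gsum: "g1 t + g2 t = g t" if "t \<in> ts_Icc T a b" for t
    using gamma_sum[OF T[OF that]] unfolding defs by (simp add: distrib_right[symmetric])
  have "small_osc T (ts_Ico T) f1 a b" "small_osc T (ts_Ico T) g1 a b"
      "small_osc T (ts_Ioc T) f2 a b" "small_osc T (ts_Ioc T) g2 a b"
    using int unfolding diamond_integrable_iff_small_osc[OF ts] defs by auto
  \<comment> \<open>Each product involves \<open>g1 + g2\<close>, so both summands are wanted for
    either side of tagging.\<close>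
  moreover from this have "small_osc T (ts_Ioc T) g1 a b" "small_osc T (ts_Ico T) g2 a b"
    using small_osc_switch[OF ts _ _ g(1)] small_osc_switch[OF ts _ _ g(2)]
    by (meson tagging_Ico tagging_Ioc)+
  \<comment> \<open>On T the weighted product is \<open>f1 * (g1 + g2)\<close>, respectively
    \<open>f2 * (g1 + g2)\<close>; as the sum equals g, the constant stays B.\<close>
  moreover have "\<bar>gamma1 T s * (f s * g s) - gamma1 T t * (f t * g t)\<bar>
      \<le> B * (\<bar>f1 s - f1 t\<bar> + \<bar>g1 s - g1 t\<bar> + \<bar>g2 s - g2 t\<bar>)"
    "\<bar>gamma2 T s * (f s * g s) - gamma2 T t * (f t * g t)\<bar>
      \<le> B * (\<bar>f2 s - f2 t\<bar> + \<bar>g1 s - g1 t\<bar> + \<bar>g2 s - g2 t\<bar>)"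
    if st: "s \<in> ts_Icc T a b" "t \<in> ts_Icc T a b" for s t
    using abs_mult_add_diff_le[of "f1 s" B "g1 t" "g2 t" "g1 s" "g2 s" "f1 t"]
      abs_mult_add_diff_le[of "f2 s" B "g1 t" "g2 t" "g1 s" "g2 s" "f2 t"]
      f[OF st(1)] B(3)[OF st(2)] unfolding gsum[OF st(1)] gsum[OF st(2)]
    by (simp_all add: f1_def f2_def mult.assoc)
  ultimately show ?thesis
    unfolding diamond_integrable_iff_small_osc[OF ts]
    using small_osc_dominated[of T "ts_Ico T" f1 a b g1 g2 B "\<lambda>t. gamma1 T t * (f t * g t)"]
      small_osc_dominated[of T "ts_Ioc T" f2 a b g1 g2 B "\<lambda>t. gamma2 T t * (f t * g t)"] B(1)
    by simp
qed

section \<open>Comparison of diamond integrals and the mean value theorem\<close>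

text \<open>Nonnegative weights preserve the inequality, so the delta and nabla parts compare
  separately and are then added.\<close>

lemma diamond_integral_le:
  assumes ts: "time_scale T" "a \<in> T" "b \<in> T" "a < b"
    and int: "diamond_integrable T u a b" "diamond_integrable T v a b"
    and le: "\<And>t. t \<in> ts_Icc T a b \<Longrightarrow> \<alpha> * u t \<le> \<beta> * v t"
  shows "\<alpha> * diamond_integral T u a b \<le> \<beta> * diamond_integral T v a b"
proof -
  \<comment> \<open>Uniqueness makes the description \<open>THE I\<close> denote the actual
    integral.\<close>
  have d: "has_tagged_integral T (ts_Ico T) h a b (delta_integral T h a b)"
    if "delta_integrable T h a b" for h
    using that has_tagged_integral_unique[OF ts tagging_Ico]
    unfolding delta_integrable_def delta_integral_def has_delta_integral_tagged by (metis theI)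
  have n: "has_tagged_integral T (ts_Ioc T) h a b (nabla_integral T h a b)"
    if "nabla_integrable T h a b" for h
    using that has_tagged_integral_unique[OF ts tagging_Ioc]
    unfolding nabla_integrable_def nabla_integral_def has_nabla_integral_tagged by (metis theI)
  have le': "\<alpha> * (gamma1 T t * u t) \<le> \<beta> * (gamma1 T t * v t)"
    "\<alpha> * (gamma2 T t * u t) \<le> \<beta> * (gamma2 T t * v t)" if t: "t \<in> ts_Icc T a b" for t
  proof -
    have "t \<in> T" using t by (simp add: ts_Icc_def)
    note nonneg = gamma_nonneg[OF this]
    show "\<alpha> * (gamma1 T t * u t) \<le> \<beta> * (gamma1 T t * v t)"
      using mult_left_mono[OF le[OF t] nonneg(1)] by (simp only: mult.left_commute)
    show "\<alpha> * (gamma2 T t * u t) \<le> \<beta> * (gamma2 T t * v t)"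
      using mult_left_mono[OF le[OF t] nonneg(2)] by (simp only: mult.left_commute)
  qed
  show ?thesis
    using has_tagged_integral_le[OF ts tagging_Ico d d le'(1)]
      has_tagged_integral_le[OF ts tagging_Ioc n n le'(2)] int
    unfolding diamond_integrable_def diamond_integral_def distrib_left by (meson add_mono)
qed

theorem theorem8p3p5:
  fixes T :: "real set" and a b m M :: real and f g :: "real \<Rightarrow> real"
  assumes "time_scale T" and "a \<in> T" and "b \<in> T" and "a < b"
    and "bounded (f ` ts_Icc T a b)" and "bounded (g ` ts_Icc T a b)"
    and "diamond_integrable T f a b" and "diamond_integrable T g a b"
    and "(\<forall>t \<in> ts_Icc T a b. g t \<ge> 0) \<or> (\<forall>t \<in> ts_Icc T a b. g t \<le> 0)"
    and "m = (INF t \<in> ts_Icc T a b. f t)" and "M = (SUP t \<in> ts_Icc T a b. f t)"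
  shows "diamond_integrable T (\<lambda>t. f t * g t) a b \<and>
    (\<exists>K. m \<le> K \<and> K \<le> M \<and>
       diamond_integral T (\<lambda>t. f t * g t) a b = K * diamond_integral T g a b)"
proof
  note ts = assms(1-4)
  show fg: "diamond_integrable T (\<lambda>t. f t * g t) a b"
    by (rule diamond_integrable_mult[OF assms(1-8)])
  define F G where "F = diamond_integral T (\<lambda>t. f t * g t) a b" and "G = diamond_integral T g a b"
  have f: "m \<le> f t" "f t \<le> M" if "t \<in> ts_Icc T a b" for t
    using that bounded_imp_bdd_below[OF assms(5)] bounded_imp_bdd_above[OF assms(5)]
    unfolding assms(10,11) by (auto intro: cINF_lower cSUP_upper)
  have "a \<in> ts_Icc T a b" using ts by (simp add: ts_Icc_def)
  then have "m \<le> M" using f[of a] by linarith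
  \<comment> \<open>The sign c turns g into a nonnegative function, so both cases of the hypothesis
    are handled at once.\<close>
  obtain c where c: "c = 1 \<or> c = -1" and cg: "\<And>t. t \<in> ts_Icc T a b \<Longrightarrow> 0 \<le> c * g t"
    using assms(9) by (metis mult_minus1 mult_1 neg_0_le_iff_le)
  have "(c * m) * g t \<le> c * (f t * g t)" "c * (f t * g t) \<le> (c * M) * g t" "0 * g t \<le> c * g t"
    if t: "t \<in> ts_Icc T a b" for t
    using mult_right_mono[OF f(1)[OF t] cg[OF t]] mult_right_mono[OF f(2)[OF t] cg[OF t]] cg[OF t]
    by (simp_all add: mult_ac)
  then have "(c * m) * G \<le> c * F" "c * F \<le> (c * M) * G" "0 * G \<le> c * G"
    unfolding F_def G_def using fg assms(8) by (intro diamond_integral_le[OF ts]; simp)+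
  then have *: "m * (c * G) \<le> c * F" "c * F \<le> M * (c * G)" "0 \<le> c * G"
    by (simp_all add: mult_ac)
  have "\<exists>K. m \<le> K \<and> K \<le> M \<and> F = K * G"
  \<comment> \<open>If G = 0, the two bounds force F = 0 and any K in [m, M] serves. Otherwise K = F
    / G, where the factor c cancels from (c * F) / (c * G).\<close>
  proof (cases "G = 0")
    case True
    then show ?thesis using * c \<open>m \<le> M\<close> by auto
  next
    case False
    then have "0 < c * G" using *(3) c by auto
    then have "m \<le> (c * F) / (c * G)" "(c * F) / (c * G) \<le> M"
      unfolding pos_le_divide_eq[OF \<open>0 < c * G\<close>] pos_divide_le_eq[OF \<open>0 < c * G\<close>]
      using * by blast+
    then show ?thesis using False c by (intro exI[of _ "F / G"]) auto
  qed
  then show "\<exists>K. m \<le> K \<and> K \<le> M \<and>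
      diamond_integral T (\<lambda>t. f t * g t) a b = K * diamond_integral T g a b"
    unfolding F_def G_def .
qed

end
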